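(* Let $\{\varphi(n)\}_{n=1}^\infty$ be a non-decreasing sequence of positive real numbers. If $\dim_H E_{\varphi(n)}=1$, then $\liminf_{n\to\infty}\frac{\log\varphi(n)}{n}=0$.
   Context: Every irrational $x\in(0,1)$ has a continued fraction expansion $x=[a_1(x),a_2(x),\dots]$ with positive integer partial quotients $a_j(x)$. Let $s_n(x)=\sum_{j=1}^n a_j(x)$. $E_{\varphi(n)}:=\{x\in(0,1)\setminus\mathbb{Q}: \lim_{n\to\infty} s_n(x)/\varphi(n)=1\}$. $\dim_H$ denotes Hausdorff dimension. *)

theory Defs
  imports "HOL-Analysis.Analysis"
begin

section \<open>Continued fractions\<close>

definition gauss_map :: "real \<Rightarrow> real" where
  "gauss_map x = frac (1 / x)"

text \<open>Partial quotients are indexed from 1; the value at index 0 is irrelevant.\<close>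

definition partial_quotient :: "nat \<Rightarrow> real \<Rightarrow> int" where
  "partial_quotient j x = \<lfloor>1 / (gauss_map ^^ (j - 1)) x\<rfloor>"

definition pq_sum :: "nat \<Rightarrow> real \<Rightarrow> int" where
  "pq_sum n x = (\<Sum>j = 1..n. partial_quotient j x)"

text \<open>
  The finite continued fraction with partial quotients \<open>a 1, \<dots>, a n\<close>. It serves only to
  show, in \<open>partial_quotient_ge_1\<close> and \<open>cf_convergents_tendsto\<close> below, that
  \<^const>\<open>partial_quotient\<close> yields the continued fraction expansion of an irrational number.
\<close>

primrec finite_cf :: "nat \<Rightarrow> (nat \<Rightarrow> int) \<Rightarrow> real" where
  "finite_cf 0 a = 0"
| "finite_cf (Suc n) a = 1 / (of_int (a 1) + finite_cf n (\<lambda>j. a (Suc j)))"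

lemma gauss_map_irrational:
  assumes "x \<in> {0<..<1} - \<rat>"
  shows "gauss_map x \<in> {0<..<1} - \<rat>"
proof -
  have "1 / x \<notin> \<rat>"
    using assms Rats_divide[of 1 "1 / x"] by auto
  then have "frac (1 / x) \<notin> \<rat>"
    using Rats_add[of "frac (1 / x)" "of_int \<lfloor>1 / x\<rfloor>"] by (auto simp: frac_def)
  moreover from this have "frac (1 / x) \<noteq> 0"
    by (metis Rats_0)
  ultimately show ?thesis
    using frac_ge_0[of "1 / x"] frac_lt_1[of "1 / x"] by (simp add: gauss_map_def)
qed

lemma gauss_map_funpow_irrational:
  assumes "x \<in> {0<..<1} - \<rat>"
  shows "(gauss_map ^^ n) x \<in> {0<..<1} - \<rat>"
proof (induction n)
  case (Suc n)
  then show ?case using gauss_map_irrational[OF Suc] by simp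
qed (use assms in simp)

lemma partial_quotient_ge_1:
  assumes "x \<in> {0<..<1} - \<rat>"
  shows "1 \<le> partial_quotient j x"
  using gauss_map_funpow_irrational[OF assms, of "j - 1"]
  by (simp add: partial_quotient_def le_floor_iff)

lemma partial_quotient_Suc_Suc:
  "partial_quotient (Suc (Suc j)) x = partial_quotient (Suc j) (gauss_map x)"
  by (simp add: partial_quotient_def funpow_Suc_right del: funpow.simps)

lemma finite_cf_cong:
  "(\<And>j. 1 \<le> j \<Longrightarrow> a j = b j) \<Longrightarrow> finite_cf n a = finite_cf n b"
proof (induction n arbitrary: a b)
  case (Suc n)
  have "finite_cf n (\<lambda>j. a (Suc j)) = finite_cf n (\<lambda>j. b (Suc j))"
    by (rule Suc.IH) (simp add: Suc.prems)
  then show ?case by (simp add: Suc.prems)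
qed simp

lemma finite_cf_partial_quotient_Suc:
  "finite_cf (Suc n) (\<lambda>j. partial_quotient j x) =
     1 / (of_int \<lfloor>1 / x\<rfloor> + finite_cf n (\<lambda>j. partial_quotient j (gauss_map x)))"
proof -
  have "finite_cf n (\<lambda>j. partial_quotient (Suc j) x) =
        finite_cf n (\<lambda>j. partial_quotient j (gauss_map x))"
  proof (rule finite_cf_cong)
    fix j :: nat assume "1 \<le> j"
    then show "partial_quotient (Suc j) x = partial_quotient j (gauss_map x)"
      by (cases j) (simp_all add: partial_quotient_Suc_Suc)
  qed
  then show ?thesis by (simp add: partial_quotient_def)
qed

lemma finite_cf_bounds:
  "(\<And>j. 1 \<le> j \<Longrightarrow> 1 \<le> a j) \<Longrightarrow> finite_cf n a \<in> {0..1}"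
proof (induction n arbitrary: a)
  case (Suc n)
  have "finite_cf n (\<lambda>j. a (Suc j)) \<in> {0..1}"
    by (rule Suc.IH) (simp add: Suc.prems)
  moreover have "1 \<le> a 1" by (rule Suc.prems) simp
  ultimately show ?case by (simp add: divide_simps)
qed simp

lemma cf_error_step:
  assumes x: "x \<in> {0<..<1} - \<rat>"
  shows "\<bar>x - finite_cf (Suc n) (\<lambda>j. partial_quotient j x)\<bar> \<le>
         x * \<bar>gauss_map x - finite_cf n (\<lambda>j. partial_quotient j (gauss_map x))\<bar>"
proof -
  define c where "c = finite_cf n (\<lambda>j. partial_quotient j (gauss_map x))"
  define q where "q = real_of_int \<lfloor>1 / x\<rfloor>"
  define d where "d = 1 / (q + c)"
  have "0 \<le> c"
    using finite_cf_bounds[of "\<lambda>j. partial_quotient j (gauss_map x)" n]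
      partial_quotient_ge_1[OF gauss_map_irrational[OF x]] by (simp add: c_def)
  moreover have "1 \<le> q"
    using partial_quotient_ge_1[OF x, of 1] by (simp add: q_def partial_quotient_def)
  ultimately have d: "0 < d" "d \<le> 1" "(q + c) * d = 1"
    by (simp_all add: d_def)
  have xq: "x * (q + gauss_map x) = 1"
    using x by (simp add: gauss_map_def frac_def q_def)
  have "x - d = x * ((q + c) * d) - (x * (q + gauss_map x)) * d"
    by (simp only: d(3) xq)
  also have "\<dots> = x * (c - gauss_map x) * d"
    by (simp add: algebra_simps)
  finally have "\<bar>x - d\<bar> = x * \<bar>gauss_map x - c\<bar> * d"
    using x d(1) by (simp add: abs_mult abs_minus_commute)
  also have "\<dots> \<le> x * \<bar>gauss_map x - c\<bar>"
    using x d by (intro mult_left_le) auto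
  finally show ?thesis
    by (simp only: finite_cf_partial_quotient_Suc d_def c_def q_def)
qed

lemma gauss_map_mult_le_half:
  assumes x: "x \<in> {0<..<1} - \<rat>"
  shows "x * gauss_map x \<le> 1 / 2"
proof -
  define q where "q = real_of_int \<lfloor>1 / x\<rfloor>"
  have q: "1 \<le> q"
    using partial_quotient_ge_1[OF x, of 1] by (simp add: q_def partial_quotient_def)
  have xq: "x * q + x * gauss_map x = 1"
    using x by (simp add: gauss_map_def frac_def q_def algebra_simps)
  have "x * gauss_map x \<le> x"
    using x gauss_map_irrational[OF x] by (intro mult_left_le) auto
  moreover have "x \<le> x * q"
    using x q by simp
  ultimately show ?thesis using xq by linarith
qed

lemma cf_error_bound:
  "x \<in> {0<..<1} - \<rat> \<Longrightarrow>
     \<bar>x - finite_cf n (\<lambda>j. partial_quotient j x)\<bar> \<le> (1 / 2) ^ (n div 2)"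
proof (induction n arbitrary: x rule: less_induct)
  case (less n)
  note x = less.prems
  show ?case
  proof (cases "n < 2")
    case True
    have "finite_cf n (\<lambda>j. partial_quotient j x) \<in> {0..1}"
      by (rule finite_cf_bounds) (rule partial_quotient_ge_1[OF x])
    then show ?thesis using x True by auto
  next
    case False
    then obtain m where m: "n = Suc (Suc m)"
      by (metis One_nat_def Suc_1 add_2_eq_Suc le_add_diff_inverse not_less)
    let ?y = "gauss_map x"
    let ?z = "gauss_map ?y"
    have y: "?y \<in> {0<..<1} - \<rat>" and z: "?z \<in> {0<..<1} - \<rat>"
      using gauss_map_irrational x by blast+
    have "\<bar>x - finite_cf n (\<lambda>j. partial_quotient j x)\<bar> \<le>
          x * \<bar>?y - finite_cf (Suc m) (\<lambda>j. partial_quotient j ?y)\<bar>"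
      unfolding m by (rule cf_error_step[OF x])
    also have "\<dots> \<le> x * (?y * \<bar>?z - finite_cf m (\<lambda>j. partial_quotient j ?z)\<bar>)"
      using x by (intro mult_left_mono cf_error_step[OF y]) auto
    also have "\<dots> = (x * ?y) * \<bar>?z - finite_cf m (\<lambda>j. partial_quotient j ?z)\<bar>"
      by simp
    also have "\<dots> \<le> (1 / 2) * (1 / 2) ^ (m div 2)"
      using gauss_map_mult_le_half[OF x] less.IH[OF _ z, of m] m by (intro mult_mono) auto
    finally show ?thesis by (simp add: m)
  qed
qed

lemma cf_convergents_tendsto:
  assumes "x \<in> {0<..<1} - \<rat>"
  shows "(\<lambda>n. finite_cf n (\<lambda>j. partial_quotient j x)) \<longlonglongrightarrow> x"
proof -
  have div2: "filterlim (\<lambda>n::nat. n div 2) sequentially sequentially"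
    unfolding filterlim_at_top
  proof
    fix Z :: nat
    show "\<forall>\<^sub>F n in sequentially. Z \<le> n div 2"
      using eventually_ge_at_top[of "2 * Z"] by eventually_elim auto
  qed
  have "(\<lambda>n. (1 / 2 :: real) ^ n) \<longlonglongrightarrow> 0"
    by (intro LIMSEQ_power_zero) simp
  from filterlim_compose[OF this div2] have "(\<lambda>n. (1 / 2 :: real) ^ (n div 2)) \<longlonglongrightarrow> 0" .
  then have "(\<lambda>n. finite_cf n (\<lambda>j. partial_quotient j x) - x) \<longlonglongrightarrow> 0"
    by (rule Lim_null_comparison[rotated])
      (use cf_error_bound[OF assms] in \<open>simp add: abs_minus_commute\<close>)
  then show ?thesis by (rule LIM_zero_cancel)
qed

definition E_set :: "(nat \<Rightarrow> real) \<Rightarrow> real set" where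
  "E_set \<phi> = {x \<in> {0<..<1} - \<rat>. (\<lambda>n. of_int (pq_sum n x) / \<phi> n) \<longlonglongrightarrow> 1}"


section \<open>Hausdorff dimension\<close>

text \<open>
  The \<open>s\<close>-th power of the diameter, with the usual conventions that the empty set contributes
  0 and that \<open>0\<^sup>0 = 1\<close> for nonempty sets (whereas \<open>0 powr 0 = 0\<close> in the library), so that
  the 0-dimensional Hausdorff measure is counting measure.
\<close>

definition diam_power :: "real \<Rightarrow> 'a::metric_space set \<Rightarrow> ennreal" where
  "diam_power s U =
     (if U = {} then 0 else if s = 0 then 1 else ennreal (diameter U powr s))"

text \<open>
  Boundedness is required of the covering sets because \<^const>\<open>diameter\<close> has no meaningful
  value on unbounded sets.
\<close>

definition hausdorff_premeasure :: "real \<Rightarrow> real \<Rightarrow> 'a::metric_space set \<Rightarrow> ennreal" where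
  "hausdorff_premeasure \<delta> s A =
     Inf {(\<Sum>i. diam_power s (U i)) | U :: nat \<Rightarrow> 'a set.
            A \<subseteq> (\<Union>i. U i) \<and> (\<forall>i. bounded (U i) \<and> diameter (U i) \<le> \<delta>)}"

definition hausdorff_measure :: "real \<Rightarrow> 'a::metric_space set \<Rightarrow> ennreal" where
  "hausdorff_measure s A = (SUP \<delta>\<in>{0<..}. hausdorff_premeasure \<delta> s A)"

definition hausdorff_dim :: "'a::metric_space set \<Rightarrow> ennreal" where
  "hausdorff_dim A = Inf {ennreal s | s. 0 \<le> s \<and> hausdorff_measure s A = 0}"

end

theory Submission
  imports Defs
begin

text \<open>
  Since \<open>\<phi>\<close> is non-decreasing, the lower limit is nonnegative. If it were positive, then
  \<open>s\<^sub>n(x)\<close> would grow at least like \<open>exp (c n)\<close> on the set \<open>E\<close>, so with \<open>b = exp (c / 2)\<close> the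
  iterates \<open>T\<^sup>n x\<close> of the Gauss map would satisfy \<open>T\<^sup>n x \<le> 1 / b ^ n\<close> infinitely often. Such
  points are covered by the images of \<open>[0, 1 / b ^ n]\<close> under the inverse branches of \<open>T\<^sup>n\<close>,
  whose diameters are at most \<open>1 / (b ^ n q\<^sub>n\<^sup>2)\<close>. Comparing the transfer operator with its
  value at \<open>s = 1\<close>, where the Gauss density is invariant, shows that the sum of \<open>1 / q\<^sub>n ^ (2 s)\<close>
  over all branches grows at most like \<open>(1 + O(1 - s)) ^ n\<close>. This is beaten by \<open>b ^ (s n)\<close> for
  some \<open>s < 1\<close>, so the dimension of \<open>E\<close> is less than 1.
\<close>

section \<open>Inverse branches of the Gauss map\<close>

text \<open>The digit \<open>k\<close> of a word stands for the partial quotient \<open>k + 1\<close>.\<close>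

primrec cf_branch :: "nat list \<Rightarrow> real \<Rightarrow> real" where
  "cf_branch [] y = y"
| "cf_branch (k # w) y = 1 / (real k + 1 + cf_branch w y)"

text \<open>\<open>cf_den w 0\<close> is the continuant q_n, and \<open>cf_den w y\<close> is q_n +
  y q_{n-1}. The product form makes its inverse square the absolute derivative of the branch at
  y.\<close>

primrec cf_den :: "nat list \<Rightarrow> real \<Rightarrow> real" where
  "cf_den [] y = 1"
| "cf_den (k # w) y = (real k + 1 + cf_branch w y) * cf_den w y"

lemma cf_branch_nonneg: "0 \<le> y \<Longrightarrow> 0 \<le> cf_branch w y"
  by (induction w) auto

lemma cf_branch_le_1: "0 \<le> y \<Longrightarrow> y \<le> 1 \<Longrightarrow> cf_branch w y \<le> 1"
  by (cases w) (auto simp: divide_simps cf_branch_nonneg add_nonneg_nonneg)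

lemma cf_den_ge_1: "0 \<le> y \<Longrightarrow> 1 \<le> cf_den w y"
proof (induction w)
  case (Cons k w)
  have "1 * 1 \<le> (real k + 1 + cf_branch w y) * cf_den w y"
    using Cons cf_branch_nonneg[of y w] by (intro mult_mono) auto
  then show ?case by simp
qed simp

text \<open>
  \<open>cf_branch w y * cf_den w y\<close> is the numerator of the branch as a fractional linear map of \<open>y\<close>;
  numerator and denominator have nonnegative coefficients.
\<close>

lemma cf_den_mono_aux:
  assumes "0 \<le> y" "y \<le> z"
  shows "cf_den w y \<le> cf_den w z \<and> cf_branch w y * cf_den w y \<le> cf_branch w z * cf_den w z"
proof (induction w)
  case (Cons k w)
  \<comment> \<open>Continuant recursion: the tail's denominator becomes the new numerator, which is
    why both monotonicity claims go through one induction.\<close>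
  have num: "cf_branch (k # w) u * cf_den (k # w) u = cf_den w u" if "0 \<le> u" for u
    using cf_branch_nonneg[OF that, of w] by simp
  have den: "cf_den (k # w) u = (real k + 1) * cf_den w u + cf_branch w u * cf_den w u" for u
    by (simp add: algebra_simps)
  have "(real k + 1) * cf_den w y \<le> (real k + 1) * cf_den w z"
    using Cons by (intro mult_left_mono) auto
  then have "cf_den (k # w) y \<le> cf_den (k # w) z"
    unfolding den using Cons by linarith
  moreover have "cf_branch (k # w) y * cf_den (k # w) y \<le> cf_branch (k # w) z * cf_den (k # w) z"
    using num[of y] num[of z] assms Cons by simp
  ultimately show ?case by blast
qed (use assms in auto)

lemma cf_den_mono: "0 \<le> y \<Longrightarrow> y \<le> z \<Longrightarrow> cf_den w y \<le> cf_den w z"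
  using cf_den_mono_aux by blast

text \<open>Each reciprocal divides distances by the product of its two arguments, and these are the
  very factors by which the two denominators grow.\<close>

lemma cf_branch_diff:
  assumes "0 \<le> y" "0 \<le> z"
  shows "\<bar>cf_branch w y - cf_branch w z\<bar> = \<bar>y - z\<bar> / (cf_den w y * cf_den w z)"
proof (induction w)
  case (Cons k w)
  define u v where "u = real k + 1 + cf_branch w y" and "v = real k + 1 + cf_branch w z"
  have uv: "0 < u" "0 < v"
    using cf_branch_nonneg[of y w] cf_branch_nonneg[of z w] assms by (auto simp: u_def v_def)
  then have "1 / u - 1 / v = (v - u) / (u * v)"
    by (simp add: field_simps)
  then have "\<bar>1 / u - 1 / v\<bar> = \<bar>u - v\<bar> / (u * v)"
    using uv by (simp add: abs_mult abs_minus_commute)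
  also have "\<bar>u - v\<bar> = \<bar>y - z\<bar> / (cf_den w y * cf_den w z)"
    using Cons by (simp add: u_def v_def)
  finally show ?case
    by (simp add: u_def v_def mult_ac)
qed simp

lemma cf_branch_dist_le:
  assumes "0 \<le> y" "0 \<le> z"
  shows "\<bar>cf_branch w y - cf_branch w z\<bar> \<le> \<bar>y - z\<bar> / (cf_den w 0)\<^sup>2"
proof -
  have "(cf_den w 0)\<^sup>2 \<le> cf_den w y * cf_den w z"
    unfolding power2_eq_square
    using assms cf_den_mono[of 0 y w] cf_den_mono[of 0 z w] cf_den_ge_1[of 0 w]
      cf_den_ge_1[of y w]
    by (intro mult_mono) auto
  then show ?thesis
    unfolding cf_branch_diff[OF assms] using cf_den_ge_1[of 0 w]
    by (intro divide_left_mono) (auto intro!: mult_pos_pos zero_less_power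
        simp: less_le_trans[OF _ cf_den_ge_1] assms)
qed

lemma diameter_cf_branch_image:
  assumes "0 \<le> r"
  shows "bounded (cf_branch w ` {0..r})"
    and "diameter (cf_branch w ` {0..r}) \<le> r / (cf_den w 0)\<^sup>2"
proof -
  have *: "dist u v \<le> r / (cf_den w 0)\<^sup>2"
    if u: "u \<in> cf_branch w ` {0..r}" and v: "v \<in> cf_branch w ` {0..r}" for u v
  proof -
    obtain y z where yz: "u = cf_branch w y" "v = cf_branch w z" "0 \<le> y" "y \<le> r" "0 \<le> z" "z \<le> r"
      using u v by auto
    have "dist u v \<le> \<bar>y - z\<bar> / (cf_den w 0)\<^sup>2"
      using cf_branch_dist_le[of y z w] yz by (simp add: dist_real_def)
    also have "\<dots> \<le> r / (cf_den w 0)\<^sup>2"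
      using yz by (intro divide_right_mono) auto
    finally show ?thesis .
  qed
  then show "bounded (cf_branch w ` {0..r})"
    unfolding bounded_two_points by blast
  show "diameter (cf_branch w ` {0..r}) \<le> r / (cf_den w 0)\<^sup>2"
    using * assms by (intro diameter_le) (auto simp: dist_norm)
qed

lemma irrational_in_cf_branch:
  assumes "x \<in> {0<..<1} - \<rat>"
  shows "\<exists>w. length w = n \<and> x = cf_branch w ((gauss_map ^^ n) x)"
  using assms
proof (induction n arbitrary: x)
  case (Suc n)
  obtain w where w: "length w = n" "gauss_map x = cf_branch w ((gauss_map ^^ n) (gauss_map x))"
    using Suc.IH[OF gauss_map_irrational[OF Suc.prems]] by blast
  have "1 \<le> \<lfloor>1 / x\<rfloor>"
    using partial_quotient_ge_1[OF Suc.prems, of 1] by (simp add: partial_quotient_def)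
  \<comment> \<open>The partial quotient is at least 1, so lowering it by 1 to get the digit loses
    nothing under \<open>nat\<close>.\<close>
  then have "real (nat (\<lfloor>1 / x\<rfloor> - 1)) + 1 = of_int \<lfloor>1 / x\<rfloor>"
    by simp
  moreover have "x = 1 / (of_int \<lfloor>1 / x\<rfloor> + gauss_map x)"
    by (simp add: gauss_map_def frac_def)
  ultimately have "x = cf_branch (nat (\<lfloor>1 / x\<rfloor> - 1) # w) ((gauss_map ^^ Suc n) x)"
    using w(2) by (simp add: funpow_Suc_right del: funpow.simps)
  then show ?case
    using w(1) by (metis length_Cons)
qed simp

section \<open>The transfer operator\<close>

text \<open>The terms telescope. Divided by 1 + x, the identity says that the Gauss density is
  invariant at s = 1.\<close>

lemma gauss_weight_sums:
  assumes "0 \<le> (x::real)"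
  shows "(\<lambda>k. (1 + x) / ((real k + 1 + x) * (real k + 2 + x))) sums 1"
proof -
  have "(\<lambda>k. (1 + x) / (real k + 1 + x)) \<longlonglongrightarrow> 0"
    using filterlim_tendsto_add_at_top[OF tendsto_const[of "1 + x"] filterlim_real_sequentially]
    by (intro real_tendsto_divide_at_top[OF tendsto_const]) (simp add: add_ac)
  from telescope_sums'[OF this]
  have "(\<lambda>k. (1 + x) / (real k + 1 + x) - (1 + x) / (real (Suc k) + 1 + x)) sums 1"
    using assms by simp
  moreover have "(1 + x) / (real k + 1 + x) - (1 + x) / (real (Suc k) + 1 + x)
      = (1 + x) / ((real k + 1 + x) * (real k + 2 + x))" for k
  proof -
    have "real k + 1 + x \<noteq> 0" "real k + 2 + x \<noteq> 0" "real (Suc k) + 1 + x = real k + 2 + x"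
      using assms by auto
    then show ?thesis by (simp add: field_simps)
  qed
  ultimately show ?thesis by simp
qed

text \<open>The Riemann zeta value at 3/2. The exponent is the decay 2 at s = 1 less the 1/2 given
  up when s drops below 1.\<close>

definition zeta32 :: real where
  "zeta32 = (\<Sum>k. (real k + 1) powr (- 3 / 2))"

lemma zeta32_sums: "(\<lambda>k. (real k + 1) powr (- 3 / 2)) sums zeta32"
proof -
  have "summable (\<lambda>k. real k powr (- 3 / 2))"
    by (simp add: summable_real_powr_iff)
  then have "summable (\<lambda>k. real (Suc k) powr (- 3 / 2))"
    by (subst summable_Suc_iff)
  then show ?thesis
    by (simp add: zeta32_def summable_sums add.commute)
qed

lemma zeta32_nonneg: "0 \<le> zeta32"
  unfolding zeta32_def using zeta32_sums by (intro suminf_nonneg) (auto simp: sums_iff)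

text \<open>With u = k + 1 + x and t = 2(1 - s), the left side is u^t / (u(u + 1)): the Gauss term
  times u^t. The excess of u^t over 1 is linear in 1 - s, at the price of a factor u^(1/2).\<close>

lemma transfer_term_bound:
  fixes x s :: real
  assumes x: "0 \<le> x" "x \<le> 1" and s: "3 / 4 \<le> s" "s \<le> 1"
  shows "(real k + 1 + x) powr (- 2 * s) / (1 + 1 / (real k + 1 + x)) \<le>
    1 / (1 + x) * ((1 + x) / ((real k + 1 + x) * (real k + 2 + x))
      + 8 * (1 - s) * (real k + 1) powr (- 3 / 2))"
proof -
  define u where "u = real k + 1 + x"
  define t where "t = 2 * (1 - s)"
  have u: "1 \<le> u" "real k + 1 \<le> u" using x by (auto simp: u_def)
  have t: "0 \<le> t" "2 * t \<le> 1" using s by (auto simp: t_def)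
  \<comment> \<open>Convexity of exp: t ln u lies between 0 and (ln u) / 2 with weight 2t. The bound
    s \<ge> 3/4 is what makes 2t \<le> 1.\<close>
  have young: "u powr t \<le> 1 + 2 * t * u powr (1 / 2)"
  proof -
    have "u powr t = exp ((1 - 2 * t) *\<^sub>R 0 + (2 * t) *\<^sub>R (ln u / 2))"
      using u by (simp add: powr_def)
    also have "\<dots> \<le> (1 - 2 * t) * exp 0 + (2 * t) * exp (ln u / 2)"
      using t by (intro convex_onD[OF exp_convex]) auto
    also have "exp (ln u / 2) = u powr (1 / 2)"
      using u by (simp add: powr_def)
    finally show ?thesis using t by simp
  qed
  have "u powr (- 2 * s) / (1 + 1 / u) = u powr t / (u * (u + 1))"
  proof -
    have "u powr t = u powr (- 2 * s) * u\<^sup>2"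
      using u by (simp add: t_def powr_add[symmetric] flip: powr_numeral)
    moreover have "1 + 1 / u = (u + 1) / u"
      using u by (simp add: field_simps)
    ultimately show ?thesis using u by (simp add: power2_eq_square)
  qed
  also have "\<dots> \<le> (1 + 2 * t * u powr (1 / 2)) / (u * (u + 1))"
    using u young by (intro divide_right_mono) auto
  also have "\<dots> = 1 / (u * (u + 1)) + 2 * t * (u powr (1 / 2) / (u * (u + 1)))"
    by (simp add: add_divide_distrib)
  also have "\<dots> \<le> 1 / (u * (u + 1)) + 2 * t * (2 / (1 + x) * (real k + 1) powr (- 3 / 2))"
  proof -
    have "u powr (1 / 2) / (u * (u + 1)) \<le> u powr (1 / 2) / u\<^sup>2"
      using u by (intro divide_left_mono) (auto simp: power2_eq_square)
    also have "\<dots> = u powr (- 3 / 2)"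
      using u by (simp add: powr_diff[symmetric] flip: powr_numeral)
    also have "\<dots> \<le> (real k + 1) powr (- 3 / 2)"
      using u by (intro powr_mono2') auto
    \<comment> \<open>As x \<le> 1, the factor 2 / (1 + x) is at least 1; it lets the density 1 / (1
      + x) be pulled out of the error term too. Together with 2t = 4(1 - s) it yields the constant
      8.\<close>
    also have "\<dots> \<le> 2 / (1 + x) * (real k + 1) powr (- 3 / 2)"
      using x by (intro mult_le_cancel_right1[THEN iffD2]) (auto simp: field_simps)
    finally show ?thesis
      using t by (intro add_left_mono mult_left_mono) auto
  qed
  also have "\<dots> = 1 / (1 + x) * ((1 + x) / (u * (u + 1)) + 8 * (1 - s) * (real k + 1) powr (- 3 / 2))"
  proof -
    have "1 / z * (z / v + 8 * (1 - s) * r) = 1 / v + 2 * t * (2 / z * r)"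
      if "z \<noteq> 0" "v \<noteq> 0" for z v r :: real
      using that by (simp add: t_def field_simps)
    then show ?thesis using x u by simp
  qed
  finally show ?thesis by (simp add: u_def add_ac)
qed

text \<open>
  \<open>1 / (1 + x)\<close> is the Gauss density, which is fixed by the transfer operator for \<open>s = 1\<close>;
  for \<open>s < 1\<close> it is therefore multiplied by at most a factor close to 1.
\<close>

lemma transfer_operator_bound:
  fixes x s :: real
  assumes x: "0 \<le> x" "x \<le> 1" and s: "3 / 4 \<le> s" "s \<le> 1"
  shows "(\<Sum>k. ennreal ((real k + 1 + x) powr (- 2 * s) / (1 + 1 / (real k + 1 + x)))) \<le>
    ennreal ((1 + 8 * (1 - s) * zeta32) / (1 + x))"
proof -
  let ?g = "\<lambda>k. 1 / (1 + x) * ((1 + x) / ((real k + 1 + x) * (real k + 2 + x))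
      + 8 * (1 - s) * (real k + 1) powr (- 3 / 2))"
  have sums: "?g sums (1 / (1 + x) * (1 + 8 * (1 - s) * zeta32))"
    by (intro sums_mult sums_add gauss_weight_sums zeta32_sums x)
  have "(\<Sum>k. ennreal ((real k + 1 + x) powr (- 2 * s) / (1 + 1 / (real k + 1 + x))))
      \<le> (\<Sum>k. ennreal (?g k))"
    by (intro suminf_le ennreal_leI transfer_term_bound assms) auto
  also have "\<dots> = ennreal (\<Sum>k. ?g k)"
    using x s sums by (intro suminf_ennreal2) (auto simp: sums_iff)
  finally show ?thesis using sums by (simp add: sums_iff)
qed

text \<open>q_n^(-2s) times the Gauss density at the point \<open>cf_branch w 0\<close>. With this
  factor, summing over a prepended digit is an application of the transfer operator to the
  density.\<close>

definition cf_weight :: "real \<Rightarrow> nat list \<Rightarrow> real" where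
  "cf_weight s w = cf_den w 0 powr (- 2 * s) / (1 + cf_branch w 0)"

lemma cf_weight_nonneg: "0 \<le> cf_weight s w"
  using cf_branch_nonneg[of 0 w] by (simp add: cf_weight_def)

lemma cf_weight_Cons:
  "cf_weight s (k # w) = cf_den w 0 powr (- 2 * s) *
     ((real k + 1 + cf_branch w 0) powr (- 2 * s) / (1 + 1 / (real k + 1 + cf_branch w 0)))"
  using cf_branch_nonneg[of 0 w] cf_den_ge_1[of 0 w]
  by (simp add: cf_weight_def powr_mult)

lemma suminf_cf_weight_Cons:
  assumes s: "3 / 4 \<le> s" "s \<le> 1"
  shows "(\<Sum>k. ennreal (cf_weight s (k # w))) \<le>
    ennreal (1 + 8 * (1 - s) * zeta32) * ennreal (cf_weight s w)"
proof -
  let ?x = "cf_branch w 0" and ?c = "cf_den w 0 powr (- 2 * s)"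
  have x: "0 \<le> ?x" "?x \<le> 1"
    by (simp_all add: cf_branch_nonneg cf_branch_le_1)
  have "(\<Sum>k. ennreal (cf_weight s (k # w))) =
    ennreal ?c * (\<Sum>k. ennreal ((real k + 1 + ?x) powr (- 2 * s) / (1 + 1 / (real k + 1 + ?x))))"
    unfolding cf_weight_Cons using x by (subst ennreal_mult) auto
  also have "\<dots> \<le> ennreal ?c * ennreal ((1 + 8 * (1 - s) * zeta32) / (1 + ?x))"
    by (intro mult_left_mono transfer_operator_bound x s) simp
  also have "\<dots> = ennreal (1 + 8 * (1 - s) * zeta32) * ennreal (cf_weight s w)"
  proof -
    define L where "L = 1 + 8 * (1 - s) * zeta32"
    have "0 \<le> L" using s zeta32_nonneg by (simp add: L_def)
    then show ?thesis
      unfolding cf_weight_def L_def[symmetric] using x by (simp add: mult.commute flip: ennreal_mult)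
  qed
  finally show ?thesis .
qed

text \<open>Sums over words are integrals for counting measure, so Tonelli allows the first digit to
  be summed out first.\<close>

lemma nn_integral_list_Cons:
  fixes f :: "nat list \<Rightarrow> ennreal"
  assumes "f [] = 0"
  shows "(\<integral>\<^sup>+w. f w \<partial>count_space UNIV) = (\<integral>\<^sup>+w. (\<Sum>k. f (k # w)) \<partial>count_space UNIV)"
proof -
  have bij: "bij_betw (\<lambda>(w, k). k # w) UNIV (- {[] :: nat list})"
    by (rule bij_betwI[where g = "\<lambda>w. (tl w, hd w)"]) auto
  have "(\<integral>\<^sup>+w. f w \<partial>count_space UNIV) = (\<integral>\<^sup>+w. f w \<partial>count_space (- {[]}))"
    using assms
    by (subst (2) nn_integral_count_space_indicator)
      (auto simp: indicator_def intro!: nn_integral_cong)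
  also have "\<dots> = (\<integral>\<^sup>+p. f (case p of (w, k) \<Rightarrow> k # w) \<partial>count_space UNIV)"
    by (rule nn_integral_bij_count_space[OF bij, symmetric])
  also have "\<dots> = (\<integral>\<^sup>+w. \<integral>\<^sup>+k. f (k # w) \<partial>count_space UNIV \<partial>count_space UNIV)"
    by (subst nn_integral_fst_count_space[symmetric]) simp
  finally show ?thesis
    by (simp add: nn_integral_count_space_nat)
qed

text \<open>Each digit costs one factor from \<open>suminf_cf_weight_Cons\<close>; the empty word
  has weight 1.\<close>

lemma sum_cf_weight_length:
  assumes s: "3 / 4 \<le> s" "s \<le> 1"
  shows "(\<integral>\<^sup>+w. ennreal (cf_weight s w) * indicator {w. length w = n} w \<partial>count_space UNIV)
    \<le> ennreal (1 + 8 * (1 - s) * zeta32) ^ n"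
proof (induction n)
  case 0
  show ?case
    by (subst nn_integral_count_space'[of "{[]}"]) (auto simp: cf_weight_def)
next
  case (Suc n)
  let ?L = "ennreal (1 + 8 * (1 - s) * zeta32)"
  have "(\<integral>\<^sup>+w. ennreal (cf_weight s w) * indicator {w. length w = Suc n} w \<partial>count_space UNIV)
    = (\<integral>\<^sup>+w. (\<Sum>k. ennreal (cf_weight s (k # w)) * indicator {w. length w = n} w) \<partial>count_space UNIV)"
    by (subst nn_integral_list_Cons) (auto simp: indicator_def intro!: nn_integral_cong)
  also have "\<dots> \<le> (\<integral>\<^sup>+w. ?L * (ennreal (cf_weight s w) * indicator {w. length w = n} w) \<partial>count_space UNIV)"
    using suminf_cf_weight_Cons[OF s] by (intro nn_integral_mono) (simp add: indicator_def del: right_diff_distrib_numeral)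
  also have "\<dots> = ?L * (\<integral>\<^sup>+w. (ennreal (cf_weight s w) * indicator {w. length w = n} w) \<partial>count_space UNIV)"
    by (rule nn_integral_cmult) simp
  also have "\<dots> \<le> ?L * ?L ^ n"
    by (intro mult_left_mono Suc) simp
  finally show ?case by simp
qed

section \<open>Hausdorff dimension of the limsup set\<close>

text \<open>Transfers the sequential covers of the definition to covers indexed by words, by a
  bijection with the naturals.\<close>

lemma hausdorff_premeasure_le_nn_integral:
  fixes U :: "'b::countable \<Rightarrow> 'a::metric_space set"
  assumes "infinite (UNIV :: 'b set)" "A \<subseteq> (\<Union>i. U i)"
    and "\<And>i. bounded (U i)" "\<And>i. diameter (U i) \<le> \<delta>"
  shows "hausdorff_premeasure \<delta> s A \<le> (\<integral>\<^sup>+i. diam_power s (U i) \<partial>count_space UNIV)"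
proof -
  obtain e :: "nat \<Rightarrow> 'b" where e: "bij_betw e UNIV UNIV"
    using bij_betw_from_nat_into[of "UNIV :: 'b set"] assms(1) by auto
  have "hausdorff_premeasure \<delta> s A \<le> (\<Sum>i. diam_power s (U (e i)))"
    unfolding hausdorff_premeasure_def
  proof (rule Inf_lower, rule CollectI, rule exI[of _ "U \<circ> e"], intro conjI)
    have "(\<Union>i. (U \<circ> e) i) = (\<Union>j\<in>range e. U j)"
      by auto
    then show "A \<subseteq> (\<Union>i. (U \<circ> e) i)"
      using assms(2) bij_betw_imp_surj_on[OF e] by simp
  qed (use assms in auto)
  also have "\<dots> = (\<integral>\<^sup>+i. diam_power s (U (e i)) \<partial>count_space UNIV)"
    by (simp add: nn_integral_count_space_nat)
  also have "\<dots> = (\<integral>\<^sup>+i. diam_power s (U i) \<partial>count_space UNIV)"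
    by (rule nn_integral_bij_count_space[OF e])
  finally show ?thesis .
qed

text \<open>A Borel-Cantelli argument: for every N the words of length at least N give a cover of A,
  and its s-sum is at most the tail of a geometric series.\<close>

lemma hausdorff_measure_limsup_eq_0:
  fixes b s :: real
  assumes s: "3 / 4 \<le> s" "s \<le> 1" and b: "1 < b"
    and theta: "(1 + 8 * (1 - s) * zeta32) * b powr (- s) < 1"
    and A: "\<And>x. x \<in> A \<Longrightarrow> x \<in> {0<..<1} - \<rat> \<and> (\<forall>N. \<exists>n\<ge>N. (gauss_map ^^ n) x \<le> inverse b ^ n)"
  shows "hausdorff_measure s A = 0"
proof -
  define L where "L = 1 + 8 * (1 - s) * zeta32"
  define \<theta> where "\<theta> = L * b powr (- s)"
  have L: "0 \<le> L" using s zeta32_nonneg by (simp add: L_def)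
  have \<theta>: "0 \<le> \<theta>" "\<theta> < 1" using L theta by (auto simp: \<theta>_def L_def)
  \<comment> \<open>Short words get the empty set, which contributes 0 to the sum, so all words can
    index the cover for each N.\<close>
  define U where "U N w = (if length w < N then {} else cf_branch w ` {0..inverse b ^ length w})" for N w
  have covers: "A \<subseteq> (\<Union>w. U N w)" for N
  proof
    fix x assume x: "x \<in> A"
    then obtain n where n: "n \<ge> N" "(gauss_map ^^ n) x \<le> inverse b ^ n" using A by blast
    obtain w where w: "length w = n" "x = cf_branch w ((gauss_map ^^ n) x)"
      using irrational_in_cf_branch A[OF x] by blast
    have "0 \<le> (gauss_map ^^ n) x"
      using gauss_map_funpow_irrational[of x n] A[OF x] by auto
    then have "x \<in> U N w" using n w by (auto simp: U_def)
    then show "x \<in> (\<Union>w. U N w)" by blast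
  qed
  have bdd: "bounded (U N w)" for N w
    using b by (simp add: U_def diameter_cf_branch_image)
  have diam: "diameter (U N w) \<le> inverse b ^ N" for N w
  proof (cases "length w < N")
    case True
    then show ?thesis using b by (simp add: U_def)
  next
    case False
    have "diameter (U N w) \<le> inverse b ^ length w / (cf_den w 0)\<^sup>2"
      using False b by (simp add: U_def diameter_cf_branch_image)
    also have "\<dots> \<le> inverse b ^ length w / 1"
      using b cf_den_ge_1[of 0 w] by (intro divide_left_mono) auto
    also have "\<dots> \<le> inverse b ^ N"
      using False b by (auto intro!: power_decreasing simp: inverse_le_1_iff)
    finally show ?thesis .
  qed
  have dp: "diam_power s (U N w) \<le> ennreal (2 * (b powr (- s)) ^ length w * cf_weight s w)"
    if "length w \<ge> N" for N w
  proof -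
    have x: "0 \<le> cf_branch w 0" "cf_branch w 0 \<le> 1"
      by (simp_all add: cf_branch_nonneg cf_branch_le_1)
    have d: "1 \<le> cf_den w 0" by (simp add: cf_den_ge_1)
    have "diameter (U N w) powr s \<le> (inverse b ^ length w / (cf_den w 0)\<^sup>2) powr s"
      using that b s bdd[of N w]
      by (intro powr_mono2 diameter_ge_0) (auto simp: U_def diameter_cf_branch_image)
    also have "\<dots> = (b powr (- s)) ^ length w * cf_den w 0 powr (- 2 * s)"
    proof -
      have "(inverse b ^ length w) powr s = (b powr (- s)) ^ length w"
        using b by (simp add: powr_def ln_realpow ln_inverse exp_of_nat_mult[symmetric] mult_ac)
      moreover have "((cf_den w 0)\<^sup>2) powr s = cf_den w 0 powr (2 * s)"
        using d by (simp add: powr_powr flip: powr_numeral)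
      ultimately show ?thesis
        using b d by (simp add: powr_divide powr_minus_divide)
    qed
    also have "\<dots> \<le> 2 * (b powr (- s)) ^ length w * cf_weight s w"
    proof -
      \<comment> \<open>The Gauss density is at least 1/2 on [0, 1]; hence the factor 2.\<close>
      have "cf_den w 0 powr (- 2 * s) \<le> 2 * cf_weight s w"
        using x by (simp add: cf_weight_def field_simps mult_left_le_one_le)
      then have "(b powr (- s)) ^ length w * cf_den w 0 powr (- 2 * s) \<le>
          (b powr (- s)) ^ length w * (2 * cf_weight s w)"
        by (intro mult_left_mono) auto
      then show ?thesis by (simp only: mult_ac)
    qed
    finally show ?thesis using s by (auto simp: diam_power_def intro!: ennreal_leI)
  qed
  have total: "(\<integral>\<^sup>+w. diam_power s (U N w) \<partial>count_space UNIV) \<le> ennreal (2 * \<theta> ^ N / (1 - \<theta>))" for N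
  proof -
    let ?I = "\<lambda>n w. indicator {w :: nat list. length w = n} w :: ennreal"
    \<comment> \<open>Splits the words by length n + N; at most one summand is nonzero for a given
      word.\<close>
    have ptw: "diam_power s (U N w) \<le>
      (\<Sum>n. ennreal (2 * (b powr (- s)) ^ (n + N)) * (ennreal (cf_weight s w) * ?I (n + N) w))" for w
    proof (cases "length w < N")
      case True
      then show ?thesis by (simp add: U_def diam_power_def)
    next
      case False
      then obtain m where m: "length w = m + N" by (metis add.commute le_Suc_ex not_less)
      have "diam_power s (U N w) \<le> ennreal (2 * (b powr (- s)) ^ (m + N)) * (ennreal (cf_weight s w) * ?I (m + N) w)"
        using dp[of N w] m by (simp add: cf_weight_nonneg flip: ennreal_mult)
      also have "\<dots> \<le> (\<Sum>n. ennreal (2 * (b powr (- s)) ^ (n + N)) * (ennreal (cf_weight s w) * ?I (n + N) w))"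
        using sum_le_suminf[of "\<lambda>n. ennreal (2 * (b powr (- s)) ^ (n + N)) * (ennreal (cf_weight s w) * ?I (n + N) w)" "{m}"]
        by simp
      finally show ?thesis .
    qed
    have "(\<integral>\<^sup>+w. diam_power s (U N w) \<partial>count_space UNIV) \<le>
      (\<integral>\<^sup>+w. (\<Sum>n. ennreal (2 * (b powr (- s)) ^ (n + N)) * (ennreal (cf_weight s w) * ?I (n + N) w)) \<partial>count_space UNIV)"
      by (intro nn_integral_mono ptw)
    also have "\<dots> = (\<Sum>n. ennreal (2 * (b powr (- s)) ^ (n + N)) *
        (\<integral>\<^sup>+w. ennreal (cf_weight s w) * ?I (n + N) w \<partial>count_space UNIV))"
      by (subst nn_integral_suminf) (auto simp: nn_integral_cmult)
    also have "\<dots> \<le> (\<Sum>n. ennreal (2 * (b powr (- s)) ^ (n + N)) * ennreal L ^ (n + N))"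
      unfolding L_def by (intro suminf_le mult_left_mono sum_cf_weight_length s) auto
    also have "\<dots> = (\<Sum>n. ennreal (2 * \<theta> ^ N * \<theta> ^ n))"
      using L by (simp add: \<theta>_def power_mult_distrib power_add ennreal_power mult_ac flip: ennreal_mult)
    also have "\<dots> = ennreal (\<Sum>n. 2 * \<theta> ^ N * \<theta> ^ n)"
      using \<theta> by (intro suminf_ennreal2) (auto intro!: summable_mult summable_geometric)
    also have "(\<Sum>n. 2 * \<theta> ^ N * \<theta> ^ n) = 2 * \<theta> ^ N / (1 - \<theta>)"
      using \<theta> by (subst suminf_mult) (auto simp: suminf_geometric summable_geometric)
    finally show ?thesis .
  qed
  have "hausdorff_premeasure \<delta> s A = 0" if "0 < \<delta>" for \<delta>
  proof -
    have "(\<lambda>N. inverse b ^ N) \<longlonglongrightarrow> 0"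
      using b by (intro LIMSEQ_power_zero) (auto simp: inverse_less_1_iff)
    then have "\<forall>\<^sub>F N in sequentially. inverse b ^ N < \<delta>"
      using that by (rule order_tendstoD)
    then have ev: "\<forall>\<^sub>F N in sequentially. hausdorff_premeasure \<delta> s A \<le> ennreal (2 * \<theta> ^ N / (1 - \<theta>))"
    proof eventually_elim
      case (elim N)
      have "hausdorff_premeasure \<delta> s A \<le> (\<integral>\<^sup>+w. diam_power s (U N w) \<partial>count_space UNIV)"
        by (intro hausdorff_premeasure_le_nn_integral covers bdd infinite_UNIV_listI
            order.trans[OF diam] less_imp_le elim)
      then show ?case using total order.trans by blast
    qed
    have "(\<lambda>N. 2 * \<theta> ^ N / (1 - \<theta>)) \<longlonglongrightarrow> 2 * 0 / (1 - \<theta>)"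
      using \<theta> by (intro tendsto_intros LIMSEQ_power_zero) auto
    then have "(\<lambda>N. ennreal (2 * \<theta> ^ N / (1 - \<theta>))) \<longlonglongrightarrow> 0"
      using tendsto_ennrealI by fastforce
    then have "hausdorff_premeasure \<delta> s A \<le> 0"
      using ev by (intro tendsto_lowerbound) auto
    then show ?thesis by simp
  qed
  then show ?thesis by (simp add: hausdorff_measure_def)
qed

text \<open>At s = 1 the geometric ratio is 1 / b < 1. By continuity it stays below 1 for some s <
  1, where the measure vanishes.\<close>

lemma hausdorff_dim_limsup_less_1:
  fixes b :: real
  assumes b: "1 < b"
    and A: "\<And>x. x \<in> A \<Longrightarrow> x \<in> {0<..<1} - \<rat> \<and> (\<forall>N. \<exists>n\<ge>N. (gauss_map ^^ n) x \<le> inverse b ^ n)"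
  shows "hausdorff_dim A < 1"
proof -
  have "((\<lambda>s. (1 + 8 * (1 - s) * zeta32) * b powr (- s)) \<longlongrightarrow> (1 + 8 * (1 - 1) * zeta32) * b powr (- 1)) (at_left 1)"
    using b by (intro tendsto_intros) auto
  moreover have "(1 + 8 * (1 - 1) * zeta32) * b powr (- 1) < 1"
    using b by (simp add: powr_minus inverse_less_1_iff)
  ultimately have "\<forall>\<^sub>F s in at_left 1. (1 + 8 * (1 - s) * zeta32) * b powr (- s) < 1"
    by (rule order_tendstoD)
  moreover have "\<forall>\<^sub>F s in at_left (1::real). s \<in> {3 / 4<..<1}"
    by (rule eventually_at_left_real) simp
  ultimately have "\<forall>\<^sub>F s in at_left (1::real). s \<in> {3 / 4<..<1} \<and> (1 + 8 * (1 - s) * zeta32) * b powr (- s) < 1"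
    by eventually_elim auto
  then obtain s where s: "3 / 4 < s" "s < 1" "(1 + 8 * (1 - s) * zeta32) * b powr (- s) < 1"
    using eventually_happens'[of "at_left (1::real)"] by fastforce
  have "hausdorff_measure s A = 0"
    using s b A by (intro hausdorff_measure_limsup_eq_0[of s b]) auto
  then have "hausdorff_dim A \<le> ennreal s"
    unfolding hausdorff_dim_def using s by (intro Inf_lower) auto
  also have "\<dots> < 1" using s by (simp add: ennreal_less_one_iff)
  finally show ?thesis .
qed

section \<open>Exponential growth of the partial quotient sums\<close>

text \<open>A lower bound on the n-th iterate bounds the next partial quotient, the floor of its
  reciprocal, by b^n. The largest bound is then used for all terms.\<close>

lemma pq_sum_le:
  assumes x: "x \<in> {0<..<1} - \<rat>" and b: "1 \<le> b"
    and M: "\<And>n. n \<ge> M \<Longrightarrow> inverse b ^ n < (gauss_map ^^ n) x"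
  shows "of_int (pq_sum (M + n) x) \<le> of_int (pq_sum M x) + real (M + n) * b ^ (M + n)"
proof (induction n)
  case 0
  then show ?case using b by simp
next
  case (Suc n)
  let ?y = "(gauss_map ^^ (M + n)) x"
  have "of_int (partial_quotient (Suc (M + n)) x) \<le> 1 / ?y"
    by (simp add: partial_quotient_def)
  also have "\<dots> \<le> 1 / inverse b ^ (M + n)"
    using M[of "M + n"] b by (intro divide_left_mono) (auto intro!: mult_pos_pos less_trans[OF _ M])
  also have "\<dots> = b ^ (M + n)" by (simp add: divide_inverse power_inverse)
  also have "\<dots> \<le> b ^ Suc (M + n)" using b by (intro power_increasing) auto
  finally have 1: "of_int (partial_quotient (Suc (M + n)) x) \<le> b ^ Suc (M + n)" .
  have "real (M + n) * b ^ (M + n) \<le> real (M + n) * b ^ Suc (M + n)"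
    using b by (intro mult_left_mono power_increasing) auto
  then show ?case using Suc 1 by (simp add: pq_sum_def algebra_simps)
qed

text \<open>Otherwise \<open>pq_sum_le\<close> would make the sums O(n exp(cn/2)), too small for the
  assumed growth. Halving c leaves room for the factor n.\<close>

lemma small_gauss_iterates_of_exp_growth:
  assumes c: "0 < c" and x: "x \<in> {0<..<1} - \<rat>"
    and growth: "\<forall>\<^sub>F n in sequentially. exp (c * real n) / 2 \<le> of_int (pq_sum n x)"
  shows "\<exists>n\<ge>N. (gauss_map ^^ n) x \<le> inverse (exp (c / 2)) ^ n"
proof (rule ccontr)
  assume "\<not> ?thesis"
  then have *: "\<And>n. n \<ge> N \<Longrightarrow> inverse (exp (c / 2)) ^ n < (gauss_map ^^ n) x"
    by force
  let ?C = "of_int (pq_sum N x) :: real"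
  define q where "q = exp (c / 2)"
  have q: "1 < q" using c by (simp add: q_def)
  have "(\<lambda>n. \<bar>?C\<bar> / q ^ n + real n / q ^ n) \<longlonglongrightarrow> 0 + 0"
    using q by (intro tendsto_add LIMSEQ_divide_realpow_zero lim_n_over_pown) auto
  then have "\<forall>\<^sub>F n in sequentially. \<bar>?C\<bar> / q ^ n + real n / q ^ n < 1 / 2"
    by (intro order_tendstoD(2)) auto
  then have "\<forall>\<^sub>F n::nat in sequentially. False"
    using growth eventually_ge_at_top[of N]
  proof eventually_elim
    case (elim n)
    have qn: "1 \<le> q ^ n" using q by simp
    have exp_eq: "exp (c * real n) = q ^ n * q ^ n"
      by (simp add: q_def exp_of_nat_mult[symmetric] exp_add[symmetric] mult_ac)
    have "of_int (pq_sum (N + (n - N)) x) \<le> ?C + real (N + (n - N)) * q ^ (N + (n - N))"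
      using q * by (intro pq_sum_le x) (auto simp: q_def)
    then have "of_int (pq_sum n x) \<le> ?C + real n * q ^ n"
      using elim by simp
    also have "\<dots> \<le> \<bar>?C\<bar> * q ^ n + real n * q ^ n"
      using mult_left_mono[OF qn, of "\<bar>?C\<bar>"] by linarith
    also have "\<dots> = (\<bar>?C\<bar> / q ^ n + real n / q ^ n) * (q ^ n * q ^ n)"
      using q by (simp add: field_simps)
    also have "\<dots> < 1 / 2 * (q ^ n * q ^ n)"
      using elim qn by (intro mult_strict_right_mono) auto
    finally show ?case
      using elim exp_eq by simp
  qed
  then show False by simp
qed

section \<open>The lower limit: nonnegativity, then exclusion of positive values\<close>

theorem theorem4:
  fixes \<phi> :: "nat \<Rightarrow> real"
  assumes "\<And>n. 1 \<le> n \<Longrightarrow> 0 < \<phi> n"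
    and "mono_on {1..} \<phi>"
    and "hausdorff_dim (E_set \<phi>) = 1"
  shows "liminf (\<lambda>n. ereal (ln (\<phi> n) / real n)) = 0"
proof (rule antisym)
  \<comment> \<open>Monotonicity bounds \<open>ln (\<phi> n) / n\<close> below by this null
    sequence.\<close>
  have "(\<lambda>n. ereal (ln (\<phi> 1) / real n)) \<longlonglongrightarrow> ereal 0"
    by (intro tendsto_ereal real_tendsto_divide_at_top[OF tendsto_const filterlim_real_sequentially])
  then have "0 = liminf (\<lambda>n. ereal (ln (\<phi> 1) / real n))"
    using lim_imp_Liminf[of sequentially "\<lambda>n. ereal (ln (\<phi> 1) / real n)" "ereal 0"]
    by (simp add: zero_ereal_def)
  also have "\<dots> \<le> liminf (\<lambda>n. ereal (ln (\<phi> n) / real n))"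
  proof (rule Liminf_mono)
    show "\<forall>\<^sub>F n in sequentially. ereal (ln (\<phi> 1) / real n) \<le> ereal (ln (\<phi> n) / real n)"
      using eventually_ge_at_top[of 1]
    proof eventually_elim
      case (elim n)
      have "\<phi> 1 \<le> \<phi> n" using assms(2) elim by (auto simp: mono_on_def)
      then show ?case using assms(1)[of 1] by (auto intro!: divide_right_mono)
    qed
  qed
  finally show "0 \<le> liminf (\<lambda>n. ereal (ln (\<phi> n) / real n))" .
next
  show "liminf (\<lambda>n. ereal (ln (\<phi> n) / real n)) \<le> 0"
  proof (rule ccontr)
    assume "\<not> ?thesis"
    then have "0 < liminf (\<lambda>n. ereal (ln (\<phi> n) / real n))" by simp
    then obtain c where c: "0 < c" "ereal c < liminf (\<lambda>n. ereal (ln (\<phi> n) / real n))"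
      using ereal_dense2[of 0] by (auto simp: zero_ereal_def)
    have "\<forall>\<^sub>F n in sequentially. ereal c < ereal (ln (\<phi> n) / real n)"
      by (rule less_LiminfD[OF c(2)])
    then have \<phi>: "\<forall>\<^sub>F n in sequentially. exp (c * real n) \<le> \<phi> n"
      using eventually_ge_at_top[of 1]
    proof eventually_elim
      case (elim n)
      then have "c * real n \<le> ln (\<phi> n)" by (simp add: field_simps)
      then show ?case using assms(1)[of n] elim by (simp add: ln_ge_iff)
    qed
    have "hausdorff_dim (E_set \<phi>) < 1"
    proof (rule hausdorff_dim_limsup_less_1[of "exp (c / 2)"], goal_cases)
      case (2 x)
      then have x: "x \<in> {0<..<1} - \<rat>" and lim: "(\<lambda>n. of_int (pq_sum n x) / \<phi> n) \<longlonglongrightarrow> 1"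
        by (auto simp: E_set_def)
      \<comment> \<open>The limit 1 is used only through the ratio exceeding 1/2 eventually, which
        passes the growth of \<open>\<phi>\<close> on to the sums.\<close>
      have "\<forall>\<^sub>F n in sequentially. 1 / 2 < of_int (pq_sum n x) / \<phi> n"
        using lim by (rule order_tendstoD) simp
      then have "\<forall>\<^sub>F n in sequentially. exp (c * real n) / 2 \<le> of_int (pq_sum n x)"
        using \<phi> eventually_ge_at_top[of 1]
      proof eventually_elim
        case (elim n)
        then show ?case using assms(1)[of n] by (simp add: field_simps)
      qed
      then show ?case
        using small_gauss_iterates_of_exp_growth[OF c(1) x] x by blast
    qed (use c in simp)
    then show False using assms(3) by simp
  qed
qed

end
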